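(* Let $P(3,1)$ be the graph with vertex set $\{u_0,u_1,u_2,v_0,v_1,v_2\}$ and edges $u_iu_{i+1}$, $v_iv_{i+1}$, $u_iv_i$ ($i=0,1,2$, indices mod $3$). Up to switching isomorphism there are exactly six signed graphs on $P(3,1)$; i.e., the set of all signatures $\Sigma\subseteq E(P(3,1))$ falls into exactly six classes under switching isomorphism.
   Context: A signature of a graph $G$ is a subset $\Sigma\subseteq E(G)$ (the negative edges). Resigning at a vertex $v$ replaces $\Sigma$ by its symmetric difference with the set of edges incident with $v$; two signatures are switching equivalent if one is obtained from the other by a sequence of resignings. Two signatures $\Sigma_1,\Sigma_2$ of $G$ are switching isomorphic if there is an automorphism $\psi$ of $G$ such that $\psi(\Sigma_1)=\{\psi(x)\psi(y):xy\in\Sigma_1\}$ is switching equivalent to $\Sigma_2$. *)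

theory Defs
  imports Main
begin

type_synonym 'a graph = "'a set \<times> 'a set set"

abbreviation verts :: "'a graph \<Rightarrow> 'a set" where
  "verts G \<equiv> fst G"

abbreviation edges :: "'a graph \<Rightarrow> 'a set set" where
  "edges G \<equiv> snd G"

definition simple_graph :: "'a graph \<Rightarrow> bool" where
  "simple_graph G \<longleftrightarrow>
     finite (verts G) \<and> (\<forall>e\<in>edges G. \<exists>x\<in>verts G. \<exists>y\<in>verts G. x \<noteq> y \<and> e = {x, y})"

definition signatures :: "'a graph \<Rightarrow> 'a set set set" where
  "signatures G = Pow (edges G)"

definition incident_edges :: "'a graph \<Rightarrow> 'a \<Rightarrow> 'a set set" where
  "incident_edges G v = {e \<in> edges G. v \<in> e}"

definition resign :: "'a graph \<Rightarrow> 'a \<Rightarrow> 'a set set \<Rightarrow> 'a set set" where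
  "resign G v S = (S - incident_edges G v) \<union> (incident_edges G v - S)"

inductive switching_equivalent :: "'a graph \<Rightarrow> 'a set set \<Rightarrow> 'a set set \<Rightarrow> bool"
  for G :: "'a graph" where
  refl: "switching_equivalent G S S"
| step: "switching_equivalent G S T \<Longrightarrow> v \<in> verts G \<Longrightarrow> switching_equivalent G S (resign G v T)"

definition automorphism :: "'a graph \<Rightarrow> ('a \<Rightarrow> 'a) \<Rightarrow> bool" where
  "automorphism G \<psi> \<longleftrightarrow>
     bij_betw \<psi> (verts G) (verts G) \<and>
     (\<forall>x\<in>verts G. \<forall>y\<in>verts G. {x, y} \<in> edges G \<longleftrightarrow> {\<psi> x, \<psi> y} \<in> edges G)"

definition map_signature :: "('a \<Rightarrow> 'a) \<Rightarrow> 'a set set \<Rightarrow> 'a set set" where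
  "map_signature \<psi> S = {{\<psi> x, \<psi> y} | x y. {x, y} \<in> S}"

definition switching_isomorphic :: "'a graph \<Rightarrow> 'a set set \<Rightarrow> 'a set set \<Rightarrow> bool" where
  "switching_isomorphic G S T \<longleftrightarrow>
     (\<exists>\<psi>. automorphism G \<psi> \<and> switching_equivalent G (map_signature \<psi> S) T)"

definition switching_isomorphism_rel :: "'a graph \<Rightarrow> ('a set set \<times> 'a set set) set" where
  "switching_isomorphism_rel G =
     {(S, T). S \<in> signatures G \<and> T \<in> signatures G \<and> switching_isomorphic G S T}"

datatype vertex = U nat | V nat

definition P31 :: "vertex graph" where
  "P31 =
     (U ` {0..<3} \<union> V ` {0..<3},
      (\<Union>i\<in>{0..<3}. {{U i, U ((i + 1) mod 3)}, {V i, V ((i + 1) mod 3)}, {U i, V i}}))"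


text \<open>
  For a simple graph, switching isomorphism is an equivalence relation on the signatures, so
  the elements of \<open>signatures G // switching_isomorphism_rel G\<close> are its classes.
\<close>

lemma switching_equivalent_trans:
  assumes "switching_equivalent G S T" and "switching_equivalent G T R"
  shows "switching_equivalent G S R"
  using assms(2,1) by induction (auto intro: switching_equivalent.step)

lemma resign_resign: "resign G v (resign G v S) = S"
  unfolding resign_def by blast

lemma switching_equivalent_sym:
  assumes "switching_equivalent G S T"
  shows "switching_equivalent G T S"
  using assms
proof induction
  case (refl S)
  show ?case by (rule switching_equivalent.refl)
next
  case (step S T v)
  have "switching_equivalent G (resign G v T) (resign G v (resign G v T))"
    using step.hyps(2) by (intro switching_equivalent.intros)
  then show ?case
    using step.IH by (auto simp: resign_resign intro: switching_equivalent_trans)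
qed

lemma switching_equivalent_signatures:
  assumes "switching_equivalent G S T" and "S \<in> signatures G"
  shows "T \<in> signatures G"
  using assms by induction (auto simp: signatures_def resign_def incident_edges_def)

lemma signature_elem:
  assumes "simple_graph G" "S \<in> signatures G" "e \<in> S"
  obtains x y where "x \<in> verts G" "y \<in> verts G" "e = {x, y}"
proof -
  have "e \<in> edges G" using assms(2,3) unfolding signatures_def by blast
  then show thesis using assms(1) that unfolding simple_graph_def by blast
qed

lemma map_signature_eq_image:
  assumes "simple_graph G" "S \<in> signatures G"
  shows "map_signature \<psi> S = (\<lambda>e. \<psi> ` e) ` S"
proof
  show "map_signature \<psi> S \<subseteq> (\<lambda>e. \<psi> ` e) ` S"
  proof
    fix f assume "f \<in> map_signature \<psi> S"
    then obtain x y where "f = {\<psi> x, \<psi> y}" "{x, y} \<in> S" unfolding map_signature_def by blast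
    then show "f \<in> (\<lambda>e. \<psi> ` e) ` S" by (intro image_eqI[of _ _ "{x, y}"]) simp_all
  qed
  show "(\<lambda>e. \<psi> ` e) ` S \<subseteq> map_signature \<psi> S"
  proof
    fix f assume "f \<in> (\<lambda>e. \<psi> ` e) ` S"
    then obtain e where e: "e \<in> S" "f = \<psi> ` e" by blast
    obtain x y where xy: "e = {x, y}" using assms e(1) by (rule signature_elem)
    then have "f = {\<psi> x, \<psi> y} \<and> {x, y} \<in> S" using e by simp
    then show "f \<in> map_signature \<psi> S" unfolding map_signature_def by blast
  qed
qed

lemma map_signature_signatures:
  assumes "simple_graph G" "automorphism G \<psi>" "S \<in> signatures G"
  shows "map_signature \<psi> S \<in> signatures G"
proof -
  have "{\<psi> x, \<psi> y} \<in> edges G" if "{x, y} \<in> S" for x y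
  proof -
    have "{x, y} \<in> edges G" using that assms(3) unfolding signatures_def by blast
    moreover from this have "x \<in> verts G \<and> y \<in> verts G"
      using signature_elem[OF assms(1) _ that] assms(3) by (metis doubleton_eq_iff)
    ultimately show ?thesis using assms(2) unfolding automorphism_def by blast
  qed
  then show ?thesis unfolding map_signature_def signatures_def by blast
qed

lemma map_signature_comp:
  assumes "simple_graph G" "automorphism G \<psi>" "S \<in> signatures G"
  shows "map_signature \<phi> (map_signature \<psi> S) = map_signature (\<phi> \<circ> \<psi>) S"
  using map_signature_signatures[OF assms] assms
  by (simp add: map_signature_eq_image image_image image_comp)

lemma automorphism_id: "automorphism G id"
  unfolding automorphism_def by simp

lemma automorphism_comp:
  assumes "automorphism G \<psi>" "automorphism G \<phi>"
  shows "automorphism G (\<phi> \<circ> \<psi>)"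
proof -
  have "\<psi> x \<in> verts G" if "x \<in> verts G" for x
    using assms(1) that unfolding automorphism_def by (auto dest: bij_betwE)
  then show ?thesis
    using assms unfolding automorphism_def by (auto intro: bij_betw_trans)
qed

lemma automorphism_inv_into:
  assumes "automorphism G \<psi>"
  shows "automorphism G (inv_into (verts G) \<psi>)"
proof -
  let ?i = "inv_into (verts G) \<psi>"
  have b: "bij_betw \<psi> (verts G) (verts G)" using assms unfolding automorphism_def by blast
  have i: "?i x \<in> verts G" "\<psi> (?i x) = x" if "x \<in> verts G" for x
    using b that by (auto simp: bij_betw_def inv_into_into f_inv_into_f)
  have "{x, y} \<in> edges G \<longleftrightarrow> {?i x, ?i y} \<in> edges G" if "x \<in> verts G" "y \<in> verts G" for x y
    using assms i[OF that(1)] i[OF that(2)] unfolding automorphism_def by metis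
  then show ?thesis using bij_betw_inv_into[OF b] unfolding automorphism_def by blast
qed

lemma map_signature_inv_into:
  assumes "simple_graph G" "automorphism G \<psi>" "S \<in> signatures G"
  shows "map_signature (inv_into (verts G) \<psi>) (map_signature \<psi> S) = S"
proof -
  have b: "inj_on \<psi> (verts G)" using assms(2) unfolding automorphism_def bij_betw_def by blast
  have "(inv_into (verts G) \<psi> \<circ> \<psi>) ` e = e" if "e \<in> S" for e
  proof -
    obtain x y where "x \<in> verts G" "y \<in> verts G" "e = {x, y}"
      by (rule signature_elem[OF assms(1,3) \<open>e \<in> S\<close>])
    then show ?thesis using b by simp
  qed
  then have "(\<lambda>e. (inv_into (verts G) \<psi> \<circ> \<psi>) ` e) ` S = (\<lambda>e. e) ` S"
    by (rule image_cong[OF HOL.refl])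
  then show ?thesis
    unfolding map_signature_comp[OF assms] by (simp add: map_signature_eq_image[OF assms(1,3)])
qed

lemma map_signature_resign:
  assumes "simple_graph G" "automorphism G \<psi>" "S \<in> signatures G" "v \<in> verts G"
  shows "map_signature \<psi> (resign G v S) = resign G (\<psi> v) (map_signature \<psi> S)"
proof -
  let ?I = "\<lambda>e. \<psi> ` e" and ?E = "edges G"
  have E: "?E \<in> signatures G" by (simp add: signatures_def)
  have inj: "inj_on \<psi> (verts G)" and surj: "\<psi> ` verts G = verts G"
    using assms(2) unfolding automorphism_def bij_betw_def by blast+
  have sub: "e \<subseteq> verts G" if "e \<in> ?E" for e
    using that assms(1) unfolding simple_graph_def by auto
  have injE: "inj_on ?I ?E"
  proof (rule inj_onI)
    fix e f assume "e \<in> ?E" "f \<in> ?E" and eq: "\<psi> ` e = \<psi> ` f"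
    then have "e \<subseteq> verts G" "f \<subseteq> verts G" by (simp_all add: sub)
    then show "e = f" using inj_on_image_eq_iff[OF inj] eq by blast
  qed
  have R: "resign G v S \<in> signatures G"
    using assms(3) by (auto simp: signatures_def resign_def incident_edges_def)
  have "?E \<subseteq> map_signature \<psi> ?E"
  proof
    fix e assume e: "e \<in> ?E"
    let ?i = "inv_into (verts G) \<psi>"
    have "map_signature ?i ?E \<subseteq> ?E"
      using map_signature_signatures[OF assms(1) automorphism_inv_into[OF assms(2)] E]
      by (simp add: signatures_def)
    then have "?i ` e \<in> ?E" using e by (auto simp: map_signature_eq_image[OF assms(1) E])
    moreover have "\<psi> ` ?i ` e = e"
      using sub[OF e] surj by (simp add: image_inv_into_cancel)
    ultimately show "e \<in> map_signature \<psi> ?E"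
      unfolding map_signature_eq_image[OF assms(1) E] by (metis imageI)
  qed
  then have surjE: "?I ` ?E = ?E"
    using map_signature_signatures[OF assms(1,2) E] map_signature_eq_image[OF assms(1) E, of \<psi>]
    by (simp add: signatures_def)
  have mem: "\<psi> v \<in> \<psi> ` e \<longleftrightarrow> v \<in> e" if "e \<in> ?E" for e
    using inj sub[OF that] assms(4) by (simp add: inj_on_image_mem_iff)
  have "?I ` incident_edges G v = {e \<in> ?I ` ?E. \<psi> v \<in> e}"
    unfolding incident_edges_def using mem by blast
  then have inc: "?I ` incident_edges G v = incident_edges G (\<psi> v)"
    unfolding surjE by (simp add: incident_edges_def)
  have SE: "S \<subseteq> ?E" and IE: "incident_edges G v \<subseteq> ?E"
    using assms(3) by (auto simp: signatures_def incident_edges_def)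
  have "?I ` (S - incident_edges G v) = ?I ` S - ?I ` incident_edges G v"
    and "?I ` (incident_edges G v - S) = ?I ` incident_edges G v - ?I ` S"
    using SE IE by (auto intro!: inj_on_image_set_diff[OF injE])
  then show ?thesis
    unfolding map_signature_eq_image[OF assms(1) R] map_signature_eq_image[OF assms(1,3)]
    by (simp add: resign_def image_Un inc)
qed

lemma map_signature_switching_equivalent:
  assumes "switching_equivalent G S T" "S \<in> signatures G" "simple_graph G" "automorphism G \<psi>"
  shows "switching_equivalent G (map_signature \<psi> S) (map_signature \<psi> T)"
  using assms
proof induction
  case (refl S)
  show ?case by (rule switching_equivalent.refl)
next
  case (step S T v)
  have "\<psi> v \<in> verts G"
    using step.hyps(2) \<open>automorphism G \<psi>\<close> unfolding automorphism_def by (auto dest: bij_betwE)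
  moreover have "T \<in> signatures G" using step by (blast intro: switching_equivalent_signatures)
  ultimately show ?case using step by (auto simp: map_signature_resign intro: switching_equivalent.step)
qed

lemma equiv_switching_isomorphism_rel:
  assumes "simple_graph G"
  shows "equiv (signatures G) (switching_isomorphism_rel G)"
proof (rule equivI)
  show "switching_isomorphism_rel G \<subseteq> signatures G \<times> signatures G"
    unfolding switching_isomorphism_rel_def by blast
  have "switching_isomorphic G S S" if "S \<in> signatures G" for S
  proof -
    have "map_signature id S = S"
      unfolding map_signature_eq_image[OF assms that] by simp
    then have "switching_equivalent G (map_signature id S) S"
      by (simp add: switching_equivalent.refl)
    then show ?thesis
      unfolding switching_isomorphic_def using automorphism_id by blast
  qed
  then show "refl_on (signatures G) (switching_isomorphism_rel G)"
    unfolding switching_isomorphism_rel_def refl_on_def by blast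
  show "sym (switching_isomorphism_rel G)"
  proof (rule symI)
    fix S T assume "(S, T) \<in> switching_isomorphism_rel G"
    then obtain \<psi> where ST: "S \<in> signatures G" "T \<in> signatures G" and a: "automorphism G \<psi>"
      and e: "switching_equivalent G (map_signature \<psi> S) T"
      unfolding switching_isomorphism_rel_def switching_isomorphic_def by blast
    let ?i = "inv_into (verts G) \<psi>"
    have ai: "automorphism G ?i" by (rule automorphism_inv_into[OF a])
    have "switching_equivalent G (map_signature ?i (map_signature \<psi> S)) (map_signature ?i T)"
      by (rule map_signature_switching_equivalent[OF e map_signature_signatures[OF assms a ST(1)] assms ai])
    then have "switching_equivalent G (map_signature ?i T) S"
      unfolding map_signature_inv_into[OF assms a ST(1)] by (rule switching_equivalent_sym)
    then show "(T, S) \<in> switching_isomorphism_rel G"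
      using ST ai unfolding switching_isomorphism_rel_def switching_isomorphic_def by blast
  qed
  show "trans (switching_isomorphism_rel G)"
  proof (rule transI)
    fix S T R
    assume "(S, T) \<in> switching_isomorphism_rel G" "(T, R) \<in> switching_isomorphism_rel G"
    then obtain \<psi> \<phi> where sig: "S \<in> signatures G" "T \<in> signatures G" "R \<in> signatures G"
      and a: "automorphism G \<psi>" "automorphism G \<phi>"
      and e: "switching_equivalent G (map_signature \<psi> S) T"
        "switching_equivalent G (map_signature \<phi> T) R"
      unfolding switching_isomorphism_rel_def switching_isomorphic_def by blast
    have "switching_equivalent G (map_signature \<phi> (map_signature \<psi> S)) (map_signature \<phi> T)"
      by (rule map_signature_switching_equivalent[OF e(1) map_signature_signatures[OF assms a(1) sig(1)] assms a(2)])
    then have "switching_equivalent G (map_signature (\<phi> \<circ> \<psi>) S) R"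
      unfolding map_signature_comp[OF assms a(1) sig(1)] using e(2) by (rule switching_equivalent_trans)
    then show "(S, R) \<in> switching_isomorphism_rel G"
      using sig automorphism_comp[OF a]
      unfolding switching_isomorphism_rel_def switching_isomorphic_def by blast
  qed
qed

lemma simple_graph_P31: "simple_graph P31"
proof -
  have idx: "i = 0 \<or> i = 1 \<or> i = 2" if "i \<in> {0..<3}" for i :: nat
    using that by auto
  have "\<exists>x\<in>verts P31. \<exists>y\<in>verts P31. x \<noteq> y \<and> e = {x, y}" if "e \<in> edges P31" for e
  proof -
    obtain i where i: "i \<in> {0..<3}"
      and e: "e = {U i, U ((i + 1) mod 3)} \<or> e = {V i, V ((i + 1) mod 3)} \<or> e = {U i, V i}"
      using \<open>e \<in> edges P31\<close> unfolding P31_def by auto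
    have v: "U j \<in> verts P31" "V j \<in> verts P31" if "j < 3" for j
      using that unfolding P31_def by simp_all
    have j: "(i + 1) mod 3 < 3" "i < 3" "i \<noteq> (i + 1) mod 3"
      using idx[OF i] by auto
    have ne: "U i \<noteq> U ((i + 1) mod 3)" "V i \<noteq> V ((i + 1) mod 3)" "U i \<noteq> V i"
      using j(3) by simp_all
    show ?thesis
      using e ne v[OF j(1)] v[OF j(2)] by metis
  qed
  moreover have "finite (verts P31)" unfolding P31_def by simp
  ultimately show ?thesis unfolding simple_graph_def by blast
qed

end

theory Submission
  imports Defs
begin

text \<open>
  Resigning along a spanning tree makes every tree edge positive, so each signature is equivalent
  to one of the 16 sets of the four remaining edges; rotations and the exchange of the two
  triangles reduce these to six. The six are told apart by two invariants: the number of negative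
  triangles and the number of negative 4-cycles. Since the cycles of length 3 and 4 of the prism
  are exactly the induced subgraphs on 3 and 4 vertices with all degrees even, the invariants can
  be counted over vertex sets.
\<close>

section \<open>Making chosen edges positive by resigning\<close>

text \<open>In \<open>unsign G (v, e)\<close> the vertex \<open>v\<close> is meant to be an end of the edge \<open>e\<close>.\<close>

definition unsign :: "'a graph \<Rightarrow> 'a \<times> 'a set \<Rightarrow> 'a set set \<Rightarrow> 'a set set" where
  "unsign G p S = (if snd p \<in> S then resign G (fst p) S else S)"

lemma switching_equivalent_unsign:
  assumes "fst p \<in> verts G"
  shows "switching_equivalent G S (unsign G p S)"
  using assms by (auto simp: unsign_def intro: switching_equivalent.intros)

lemma switching_equivalent_fold_unsign:
  assumes "fst ` set ps \<subseteq> verts G"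
  shows "switching_equivalent G S (fold (unsign G) ps S)"
  using assms
proof (induction ps arbitrary: S)
  case Nil
  show ?case by (simp add: switching_equivalent.refl)
next
  case (Cons p ps)
  then show ?case
    by (auto intro: switching_equivalent_trans[OF switching_equivalent_unsign])
qed

lemma unsign_not_in:
  assumes "e \<in> edges G" "v \<in> e"
  shows "e \<notin> unsign G (v, e) S"
  using assms by (auto simp: unsign_def resign_def incident_edges_def)

lemma unsign_other:
  assumes "v \<notin> f"
  shows "f \<in> unsign G (v, e) S \<longleftrightarrow> f \<in> S"
  using assms by (auto simp: unsign_def resign_def incident_edges_def)

text \<open>Induct from the end of the list: the last step makes its own edge positive, and its
  vertex lies on no earlier edge, so it leaves the signs of those edges alone.\<close>

lemma fold_unsign_disjoint:
  assumes "\<And>v e. (v, e) \<in> set ps \<Longrightarrow> e \<in> edges G \<and> v \<in> e"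
    and "sorted_wrt (\<lambda>p q. fst q \<notin> snd p) ps"
  shows "snd ` set ps \<inter> fold (unsign G) ps S = {}"
  using assms
proof (induction ps rule: rev_induct)
  case Nil
  show ?case by simp
next
  case (snoc p ps)
  obtain v e where p: "p = (v, e)" by (cases p)
  have "f \<notin> fold (unsign G) (ps @ [p]) S" if "(w, f) \<in> set ps" for w f
  proof -
    have "f \<notin> fold (unsign G) ps S"
      using snoc that by (force simp: sorted_wrt_append)
    moreover have "v \<notin> f" using snoc.prems(2) that p by (force simp: sorted_wrt_append)
    ultimately show ?thesis by (simp add: p unsign_other)
  qed
  moreover have "e \<notin> fold (unsign G) (ps @ [p]) S"
    using snoc.prems(1)[of v e] by (simp add: p unsign_not_in)
  ultimately show ?case using p by auto
qed

section \<open>Counts of negative cycles as invariants\<close>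

definition induced_edges :: "'a graph \<Rightarrow> 'a set \<Rightarrow> 'a set set" where
  "induced_edges G X = {e \<in> edges G. e \<subseteq> X}"

text \<open>Vertex sets stand in for cycles so that the family can be enumerated by evaluation. The
  intersection consists of the edges at \<open>v\<close> in the induced subgraph, so its size is the
  degree of \<open>v\<close> there, and 0 if \<open>v\<close> lies outside \<open>X\<close>.\<close>

definition even_induced :: "'a graph \<Rightarrow> nat \<Rightarrow> 'a set set" where
  "even_induced G k = {X \<in> Pow (verts G). card X = k \<and>
     (\<forall>v\<in>verts G. even (card (induced_edges G X \<inter> incident_edges G v)))}"

definition negative_count :: "'a graph \<Rightarrow> nat \<Rightarrow> 'a set set \<Rightarrow> nat" where
  "negative_count G k S = card {X \<in> even_induced G k. odd (card (induced_edges G X \<inter> S))}"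

text \<open>Resigning is symmetric difference with the edges at \<open>v\<close>; modulo 2 it adds
  the number of such edges in \<open>C\<close>, which is even.\<close>

lemma odd_card_Int_resign:
  assumes "finite C" "even (card (C \<inter> incident_edges G v))"
  shows "odd (card (C \<inter> resign G v S)) \<longleftrightarrow> odd (card (C \<inter> S))"
proof -
  let ?I = "incident_edges G v"
  \<comment> \<open>Three disjoint pieces of \<open>C\<close> occur, of sizes a, b, d: only in
    \<open>S\<close>, only in \<open>?I\<close>, in both. The three sets have sizes a+b, a+d, b+d,
    and b+d is even.\<close>
  have "C \<inter> resign G v S = (C \<inter> S - ?I) \<union> (C \<inter> ?I - S)"
    and "C \<inter> S = (C \<inter> S - ?I) \<union> (C \<inter> S \<inter> ?I)"
    and "C \<inter> ?I = (C \<inter> ?I - S) \<union> (C \<inter> S \<inter> ?I)"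
    by (auto simp: resign_def)
  then have "card (C \<inter> resign G v S) = card (C \<inter> S - ?I) + card (C \<inter> ?I - S)"
    and "card (C \<inter> S) = card (C \<inter> S - ?I) + card (C \<inter> S \<inter> ?I)"
    and "card (C \<inter> ?I) = card (C \<inter> ?I - S) + card (C \<inter> S \<inter> ?I)"
    using assms(1) by (metis (no_types, lifting) card_Un_disjoint finite_Int finite_Diff Int_Diff
        Diff_disjoint Int_commute Int_left_commute Diff_Int_distrib2 inf_bot_right Diff_Diff_Int)+
  then show ?thesis using assms(2) by simp
qed

lemma finite_edges:
  assumes "simple_graph G"
  shows "finite (edges G)"
proof -
  have "edges G \<subseteq> Pow (verts G)" using assms by (auto simp: simple_graph_def)
  then show ?thesis using assms by (auto simp: simple_graph_def intro: finite_subset)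
qed

lemma negative_count_switching_equivalent:
  assumes "switching_equivalent G S T" "simple_graph G"
  shows "negative_count G k S = negative_count G k T"
  using assms(1)
proof induction
  case (refl S)
  show ?case ..
next
  case (step S T v)
  have "odd (card (induced_edges G X \<inter> resign G v T)) \<longleftrightarrow> odd (card (induced_edges G X \<inter> T))"
    if "X \<in> even_induced G k" for X
    using that step.hyps(2) finite_edges[OF assms(2)]
    by (intro odd_card_Int_resign) (auto simp: even_induced_def induced_edges_def)
  then have "{X \<in> even_induced G k. odd (card (induced_edges G X \<inter> resign G v T))} =
      {X \<in> even_induced G k. odd (card (induced_edges G X \<inter> T))}" by blast
  then show ?case using step.IH by (simp add: negative_count_def)
qed

text \<open>Taking images under \<open>\<psi>\<close> injects the vertex sets counted for
  \<open>S\<close> into those counted for its image. The inequality becomes an equality below by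
  symmetry of the relation.\<close>

lemma negative_count_map_signature:
  assumes "simple_graph G" "automorphism G \<psi>" "S \<in> signatures G"
  shows "negative_count G k S \<le> negative_count G k (map_signature \<psi> S)"
proof -
  let ?I = "\<lambda>e. \<psi> ` e"
  have inj: "inj_on \<psi> (verts G)" and surj: "\<psi> ` verts G = verts G"
    using assms(2) by (auto simp: automorphism_def bij_betw_def)
  have EV: "edges G \<subseteq> Pow (verts G)" using assms(1) by (auto simp: simple_graph_def)
  then have injE: "inj_on ?I (edges G)"
    using inj_on_image_Pow[OF inj] by (rule inj_on_subset[rotated])
  have map: "map_signature \<psi> T = ?I ` T" if "T \<subseteq> edges G" for T
    using map_signature_eq_image[OF assms(1)] that by (simp add: signatures_def)
  \<comment> \<open>Resigning the empty signature at \<open>v\<close> yields exactly the edges at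
    \<open>v\<close>, so this is an instance of \<open>map_signature_resign\<close>.\<close>
  have inc: "?I ` incident_edges G v = incident_edges G (\<psi> v)" if "v \<in> verts G" for v
    using map_signature_resign[OF assms(1,2) _ that, of "{}"] map
    by (simp add: resign_def signatures_def incident_edges_def)
  have card_Int: "card (?I ` C \<inter> ?I ` T) = card (C \<inter> T)"
    if "C \<subseteq> edges G" "T \<subseteq> edges G" for C T
  proof -
    have "?I ` C \<inter> ?I ` T = ?I ` (C \<inter> T)"
      using injE that by (simp add: inj_on_image_Int)
    moreover have "inj_on ?I (C \<inter> T)" using injE that by (meson inf.coboundedI1 inj_on_subset)
    ultimately show ?thesis by (simp add: card_image)
  qed
  have SE: "S \<subseteq> edges G" using assms(3) by (simp add: signatures_def)
  have ind: "?I ` induced_edges G X = induced_edges G (\<psi> ` X)" if "X \<subseteq> verts G" for X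
  proof -
    have "?I ` edges G \<subseteq> edges G"
      using map_signature_signatures[OF assms(1,2), of "edges G"] map[of "edges G"]
      by (simp only: signatures_def Pow_iff subset_refl simp_thms)
    then have "?I ` edges G = edges G"
      using finite_edges[OF assms(1)] injE by (intro endo_inj_surj)
    moreover have "\<psi> ` e \<subseteq> \<psi> ` X \<longleftrightarrow> e \<subseteq> X" if "e \<in> edges G" for e
    proof -
      have "\<psi> x \<in> \<psi> ` X \<longleftrightarrow> x \<in> X" if "x \<in> e" for x
        using EV \<open>e \<in> edges G\<close> \<open>X \<subseteq> verts G\<close> that by (intro inj_on_image_mem_iff[OF inj]) blast+
      then show ?thesis by (auto simp: image_subset_iff)
    qed
    then have "?I ` induced_edges G X = {e \<in> ?I ` edges G. e \<subseteq> \<psi> ` X}"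
      unfolding induced_edges_def by blast
    ultimately show ?thesis by (simp add: induced_edges_def)
  qed
  have indE: "induced_edges G X \<subseteq> edges G" for X by (auto simp: induced_edges_def)
  let ?N = "\<lambda>S. {X \<in> even_induced G k. odd (card (induced_edges G X \<inter> S))}"
  have sub: "(\<lambda>X. \<psi> ` X) ` ?N S \<subseteq> ?N (map_signature \<psi> S)"
  proof (rule image_subsetI)
    fix X assume "X \<in> ?N S"
    then have X: "X \<in> even_induced G k" "odd (card (induced_edges G X \<inter> S))"
      and XV: "X \<subseteq> verts G" by (auto simp: even_induced_def)
    \<comment> \<open>Used for \<open>T\<close> the edges at a vertex, to transfer even degrees, and
      for \<open>T\<close> equal to \<open>S\<close>, to transfer the parity of negative
      edges.\<close>
    have card: "card (induced_edges G (\<psi> ` X) \<inter> ?I ` T) = card (induced_edges G X \<inter> T)"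
      if "T \<subseteq> edges G" for T
      unfolding ind[OF XV, symmetric] by (rule card_Int[OF indE that])
    have "\<psi> ` X \<subseteq> verts G" using XV surj by blast
    moreover have "card (\<psi> ` X) = k"
      using X(1) inj_on_subset[OF inj XV] by (simp add: even_induced_def card_image)
    moreover have "even (card (induced_edges G (\<psi> ` X) \<inter> incident_edges G w))"
      if "w \<in> verts G" for w
    proof -
      obtain v where v: "v \<in> verts G" "w = \<psi> v" using surj \<open>w \<in> verts G\<close> by blast
      then show ?thesis
        using card[of "incident_edges G v"] inc X(1)
        by (simp add: even_induced_def incident_edges_def)
    qed
    moreover have "odd (card (induced_edges G (\<psi> ` X) \<inter> map_signature \<psi> S))"
      using X(2) card[OF SE] map[OF SE] by simp
    ultimately show "\<psi> ` X \<in> ?N (map_signature \<psi> S)" by (simp add: even_induced_def)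
  qed
  have "inj_on (\<lambda>X. \<psi> ` X) (?N S)"
    using inj_on_image_Pow[OF inj] by (rule inj_on_subset) (auto simp: even_induced_def)
  moreover have "finite (?N (map_signature \<psi> S))"
    using assms(1) by (simp add: even_induced_def simple_graph_def)
  ultimately show ?thesis unfolding negative_count_def by (intro card_inj_on_le[OF _ sub])
qed

lemma negative_count_switching_isomorphism:
  assumes "simple_graph G" "(S, T) \<in> switching_isomorphism_rel G"
  shows "negative_count G k S = negative_count G k T"
proof -
  have le: "negative_count G k S \<le> negative_count G k T"
    if "(S, T) \<in> switching_isomorphism_rel G" for S T
  proof -
    obtain \<psi> where "automorphism G \<psi>" "S \<in> signatures G"
      "switching_equivalent G (map_signature \<psi> S) T"
      using \<open>(S, T) \<in> switching_isomorphism_rel G\<close>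
      unfolding switching_isomorphism_rel_def switching_isomorphic_def by blast
    then show ?thesis
      using negative_count_map_signature[OF assms(1)]
        negative_count_switching_equivalent[OF _ assms(1)] by metis
  qed
  have "(T, S) \<in> switching_isomorphism_rel G"
    using equiv_switching_isomorphism_rel[OF assms(1)] assms(2) by (meson equivE symE)
  then show ?thesis using le assms(2) by (simp add: le_antisym)
qed

section \<open>Symmetries and sign patterns of the prism\<close>

fun shift :: "bool \<Rightarrow> nat \<Rightarrow> vertex \<Rightarrow> vertex" where
  "shift b k (U i) = (if b then V else U) ((i + k) mod 3)"
| "shift b k (V i) = (if b then U else V) ((i + k) mod 3)"

lemma automorphism_shift:
  assumes "k \<in> {0, 1, 2}"
  shows "automorphism P31 (shift b k)"
proof -
  \<comment> \<open>Bounding \<open>b\<close> and \<open>k\<close> by explicit sets turns all six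
    cases into one closed statement that evaluation decides.\<close>
  have "\<forall>b\<in>{True, False}. \<forall>k\<in>{0, 1, 2}.
      shift b k ` verts P31 = verts P31 \<and> inj_on (shift b k) (verts P31) \<and>
      (\<forall>x\<in>verts P31. \<forall>y\<in>verts P31.
        {x, y} \<in> edges P31 \<longleftrightarrow> {shift b k x, shift b k y} \<in> edges P31)"
    by code_simp
  then show ?thesis
    using assms unfolding automorphism_def bij_betw_def by (cases b) auto
qed

text \<open>
  The order matters: no resigning vertex lies on an earlier edge of the list, so edges already made
  positive stay positive.
\<close>

definition spanning_tree :: "(vertex \<times> vertex set) list" where
  "spanning_tree = [(U 2, {U 2, U 0}), (U 1, {U 1, U 2}), (V 0, {U 0, V 0}),
    (V 1, {U 1, V 1}), (V 2, {U 2, V 2})]"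

text \<open>The edges off \<open>spanning_tree\<close>.\<close>

definition chords :: "vertex set set" where
  "chords = {{U 0, U 1}, {V 0, V 1}, {V 1, V 2}, {V 2, V 0}}"

text \<open>Each edge of the prism lies on two of its five faces, so the number of negative faces is
  even. With two triangles and three 4-cycles this leaves six possible pairs of counts; each is
  realised once here.\<close>

definition reps :: "vertex set set set" where
  "reps = {{}, {{U 0, U 1}, {V 0, V 1}}, {{V 1, V 2}}, {{V 1, V 2}, {V 2, V 0}}, chords,
    {{V 0, V 1}, {V 1, V 2}, {V 2, V 0}}}"

text \<open>
  An entry \<open>(T, b, k)\<close> records that \<open>shift b k\<close> followed by resigning along the spanning tree
  takes \<open>T\<close> to a representative.
\<close>

definition witnesses :: "(vertex set set \<times> bool \<times> nat) list" where
  "witnesses = (let a = {U 0, U 1}; x = {V 0, V 1}; y = {V 1, V 2}; z = {V 2, V 0} in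
    [({}, False, 0), ({a, x}, False, 0), ({y}, False, 0), ({y, z}, False, 0),
     ({a, x, y, z}, False, 0), ({x, y, z}, False, 0),
     ({a}, True, 1), ({x}, False, 1), ({z}, False, 2), ({x, y}, False, 1), ({x, z}, False, 2),
     ({a, y}, False, 1), ({a, z}, False, 2), ({a, x, y}, True, 0), ({a, x, z}, True, 2),
     ({a, y, z}, True, 0)])"

lemma fst_witnesses: "Pow chords \<subseteq> fst ` set witnesses"
  by code_simp

lemma witnesses_reps:
  "\<forall>(T, b, k)\<in>set witnesses.
     k \<in> {0, 1, 2} \<and> fold (unsign P31) spanning_tree ((\<lambda>e. shift b k ` e) ` T) \<in> reps"
  by code_simp

lemma even_induced_P31_3: "even_induced P31 3 = {{U 0, U 1, U 2}, {V 0, V 1, V 2}}"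
  by code_simp

lemma even_induced_P31_4:
  "even_induced P31 4 = {{U 0, U 1, V 0, V 1}, {U 1, U 2, V 1, V 2}, {U 2, U 0, V 2, V 0}}"
  by code_simp

text \<open>In the order of \<open>reps\<close> the pairs are (0,0), (2,0), (1,1), (0,2), (2,2),
  (1,3). Inserting the explicit triangles and 4-cycles first leaves only five vertex sets to
  evaluate.\<close>

lemma inj_on_reps: "inj_on (\<lambda>S. (negative_count P31 3 S, negative_count P31 4 S)) reps"
  unfolding negative_count_def even_induced_P31_3 even_induced_P31_4
  by code_simp

lemma card_reps: "card reps = 6"
  by code_simp

lemma edges_P31:
  "edges P31 = chords \<union> {{U 2, U 0}, {U 1, U 2}, {U 0, V 0}, {U 1, V 1}, {U 2, V 2}}"
  by code_simp

lemma spanning_tree_verts: "fst ` set spanning_tree \<subseteq> verts P31"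
  by (simp add: spanning_tree_def P31_def)

section \<open>Reduction to the six representatives\<close>

lemma shift_in_switching_isomorphism_rel:
  assumes "S \<in> signatures P31" "k \<in> {0, 1, 2}"
  shows "(S, (\<lambda>e. shift b k ` e) ` S) \<in> switching_isomorphism_rel P31"
proof -
  have "map_signature (shift b k) S = (\<lambda>e. shift b k ` e) ` S"
    by (rule map_signature_eq_image[OF simple_graph_P31 assms(1)])
  moreover have "map_signature (shift b k) S \<in> signatures P31"
    by (rule map_signature_signatures[OF simple_graph_P31 automorphism_shift[OF assms(2)] assms(1)])
  moreover have "switching_isomorphic P31 S (map_signature (shift b k) S)"
    unfolding switching_isomorphic_def
    using automorphism_shift[OF assms(2)] switching_equivalent.refl by blast
  ultimately show ?thesis using assms(1) by (simp add: switching_isomorphism_rel_def)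
qed

lemma switching_equivalent_in_switching_isomorphism_rel:
  assumes "simple_graph G" "S \<in> signatures G" "switching_equivalent G S T"
  shows "(S, T) \<in> switching_isomorphism_rel G"
proof -
  have "map_signature id S = S" using map_signature_eq_image[OF assms(1,2), of id] by simp
  then have "switching_isomorphic G S T"
    unfolding switching_isomorphic_def using automorphism_id assms(3) by metis
  then show ?thesis
    using assms(2) switching_equivalent_signatures[OF assms(3,2)]
    by (simp add: switching_isomorphism_rel_def)
qed

lemma fold_unsign_spanning_tree_in_rel:
  assumes "S \<in> signatures P31"
  shows "(S, fold (unsign P31) spanning_tree S) \<in> switching_isomorphism_rel P31"
  using assms switching_equivalent_fold_unsign[OF spanning_tree_verts] simple_graph_P31
  by (blast intro: switching_equivalent_in_switching_isomorphism_rel)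

lemma fold_unsign_spanning_tree_chords:
  assumes "S \<in> signatures P31"
  shows "fold (unsign P31) spanning_tree S \<subseteq> chords"
proof -
  have "snd ` set spanning_tree \<inter> fold (unsign P31) spanning_tree S = {}"
    by (rule fold_unsign_disjoint) (auto simp: edges_P31 spanning_tree_def)
  moreover have "fold (unsign P31) spanning_tree S \<subseteq> edges P31"
    using fold_unsign_spanning_tree_in_rel[OF assms]
    by (simp add: switching_isomorphism_rel_def signatures_def)
  ultimately show ?thesis by (auto simp: edges_P31 spanning_tree_def)
qed

text \<open>A first pass along the tree moves all negative edges into \<open>chords\<close>. The
  recorded symmetry may put some back on the tree, and a second pass then ends in
  \<open>reps\<close>.\<close>

lemma rep_exists:
  assumes "S \<in> signatures P31"
  shows "\<exists>R\<in>reps. (S, R) \<in> switching_isomorphism_rel P31"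
proof -
  have trans: "trans (switching_isomorphism_rel P31)"
    using equiv_switching_isomorphism_rel[OF simple_graph_P31] by (auto simp: equiv_def)
  define T where "T = fold (unsign P31) spanning_tree S"
  have ST: "(S, T) \<in> switching_isomorphism_rel P31"
    unfolding T_def by (rule fold_unsign_spanning_tree_in_rel[OF assms])
  have "T \<in> Pow chords" unfolding T_def using fold_unsign_spanning_tree_chords[OF assms] by blast
  then have "T \<in> fst ` set witnesses" using fst_witnesses by blast
  then obtain b k where "(T, b, k) \<in> set witnesses" by auto
  then have k: "k \<in> {0, 1, 2}"
    and R: "fold (unsign P31) spanning_tree ((\<lambda>e. shift b k ` e) ` T) \<in> reps"
    using witnesses_reps by fast+
  have "(T, (\<lambda>e. shift b k ` e) ` T) \<in> switching_isomorphism_rel P31"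
    using shift_in_switching_isomorphism_rel[OF _ k] ST by (simp add: switching_isomorphism_rel_def)
  moreover from this have "((\<lambda>e. shift b k ` e) ` T,
      fold (unsign P31) spanning_tree ((\<lambda>e. shift b k ` e) ` T)) \<in> switching_isomorphism_rel P31"
    by (intro fold_unsign_spanning_tree_in_rel) (simp add: switching_isomorphism_rel_def)
  ultimately show ?thesis using ST R trans by (meson transD)
qed

theorem theorem6:
  shows "card (signatures P31 // switching_isomorphism_rel P31) = 6"
proof -
  let ?r = "switching_isomorphism_rel P31"
  have equiv: "equiv (signatures P31) ?r"
    by (rule equiv_switching_isomorphism_rel[OF simple_graph_P31])
  have reps: "reps \<subseteq> signatures P31"
    by (auto simp: reps_def signatures_def edges_P31 chords_def)
  \<comment> \<open>The classes are counted through \<open>reps\<close>: sending a representative to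
    its class is onto here and injective below.\<close>
  have "signatures P31 // ?r = (\<lambda>R. ?r `` {R}) ` reps"
  proof
    show "signatures P31 // ?r \<subseteq> (\<lambda>R. ?r `` {R}) ` reps"
    proof
      fix c assume "c \<in> signatures P31 // ?r"
      then obtain S where S: "S \<in> signatures P31" "c = ?r `` {S}" by (rule quotientE)
      obtain R where "R \<in> reps" "(S, R) \<in> ?r" using rep_exists[OF S(1)] by blast
      then show "c \<in> (\<lambda>R. ?r `` {R}) ` reps"
        using equiv_class_eq[OF equiv] S(2) by blast
    qed
    show "(\<lambda>R. ?r `` {R}) ` reps \<subseteq> signatures P31 // ?r"
      using reps by (auto intro: quotientI)
  qed
  moreover have "inj_on (\<lambda>R. ?r `` {R}) reps"
  proof (rule inj_onI)
    fix R R' assume R: "R \<in> reps" "R' \<in> reps" and "?r `` {R} = ?r `` {R'}"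
    then have "(R, R') \<in> ?r" using eq_equiv_class[OF _ equiv] reps by blast
    \<comment> \<open>Two representatives of one class share the counts for k = 3 and k = 4, which
      already separate \<open>reps\<close>.\<close>
    then have "negative_count P31 k R = negative_count P31 k R'" for k
      by (rule negative_count_switching_isomorphism[OF simple_graph_P31])
    then show "R = R'" using R by (intro inj_onD[OF inj_on_reps]) simp_all
  qed
  ultimately show ?thesis by (simp add: card_image card_reps)
qed

end
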